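(* Let $\rho\in\mathfrak{M}$ be a minimizer of the action $S$ and let $\ell(x)=\int_F L(x,y)\,d\rho(y)$ for $x\in F$. Then $\ell$ is constant on $\operatorname{supp}\rho$, with $$\ell|_{\operatorname{supp}\rho}\equiv\inf_F\ell=S_{\min}.$$
   Context: $F$ is a smooth compact manifold, $D\in C^\infty(F\times F,\mathbb{R})$ is symmetric ($D(x,y)=D(y,x)$) with $D(x,x)>0$ for all $x\in F$, and $L=\max(0,D)$. $\mathfrak{M}$ is the set of all normalized (total mass one) positive regular Borel measures on $F$; $S[\rho]=\iint_{F\times F}L(x,y)\,d\rho(x)\,d\rho(y)$ and $S_{\min}=\inf_{\tilde\rho\in\mathfrak{M}}S[\tilde\rho]$. A minimizer is a $\rho\in\mathfrak{M}$ with $S[\rho]=S_{\min}$. The support is $\operatorname{supp}\rho=\{x\in F:\rho(U)\neq0\text{ for every open neighborhood }U\text{ of }x\}$. *)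

theory Defs
  imports "HOL-Analysis.Analysis" "HOL-Probability.Probability"
begin

section \<open>Smooth functions on open subsets of a finite-dimensional space\<close>

text \<open>
  \<open>Ck_on k U f\<close> is meant for open \<open>U\<close>. For a finite-dimensional domain, having continuous
  directional derivatives up to order \<open>k\<close> in all directions is the usual class \<open>C^k\<close>.
\<close>

primrec Ck_on ::
  "nat \<Rightarrow> 'e::real_normed_vector set \<Rightarrow> ('e \<Rightarrow> 'f::real_normed_vector) \<Rightarrow> bool" where
  "Ck_on 0 U f \<longleftrightarrow> continuous_on U f"
| "Ck_on (Suc k) U f \<longleftrightarrow>
     (\<forall>x\<in>U. f differentiable (at x)) \<and>
     (\<forall>v. Ck_on k U (\<lambda>x. frechet_derivative f (at x) v))"

definition smooth_on ::
  "'e::real_normed_vector set \<Rightarrow> ('e \<Rightarrow> 'f::real_normed_vector) \<Rightarrow> bool" where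
  "smooth_on U f \<longleftrightarrow> (\<forall>k. Ck_on k U f)"


section \<open>Compact smooth manifolds\<close>

text \<open>
  The manifold is a whole type \<open>'a\<close>, whose topology is Hausdorff and second countable by its
  sort. A chart is a pair \<open>(U, \<phi>)\<close>; the values of \<open>\<phi>\<close> outside \<open>U\<close> are irrelevant.
  The model space \<open>'e\<close> is an arbitrary finite-dimensional normed space rather than a
  \<^class>\<open>euclidean_space\<close>, since the latter class excludes dimension 0. The choice of norm
  is immaterial, as all norms on such a space are equivalent.
\<close>

type_synonym ('a, 'e) chart = "'a set \<times> ('a \<Rightarrow> 'e)"

definition is_chart :: "('a::topological_space, 'e::real_normed_vector) chart \<Rightarrow> bool" where
  "is_chart = (\<lambda>(U, \<phi>). open U \<and> open (\<phi> ` U) \<and> (\<exists>\<psi>. homeomorphism U (\<phi> ` U) \<phi> \<psi>))"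

definition smooth_transition ::
  "('a, 'e::real_normed_vector) chart \<Rightarrow> ('a, 'e) chart \<Rightarrow> bool" where
  "smooth_transition = (\<lambda>(U, \<phi>) (V, \<psi>). smooth_on (\<phi> ` (U \<inter> V)) (\<psi> \<circ> inv_into U \<phi>))"

definition smooth_atlas ::
  "('a::{t2_space, second_countable_topology}, 'e::real_normed_vector) chart set \<Rightarrow> bool" where
  "smooth_atlas \<A> \<longleftrightarrow>
     (\<exists>B :: 'e set. finite B \<and> span B = UNIV) \<and>
     (\<forall>c\<in>\<A>. is_chart c) \<and>
     (\<Union>c\<in>\<A>. fst c) = UNIV \<and>
     (\<forall>c\<in>\<A>. \<forall>d\<in>\<A>. smooth_transition c d)"

definition compact_smooth_manifold ::
  "('a::{t2_space, second_countable_topology}, 'e::real_normed_vector) chart set \<Rightarrow> bool" where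
  "compact_smooth_manifold \<A> \<longleftrightarrow> smooth_atlas \<A> \<and> compact (UNIV :: 'a set)"

definition product_atlas ::
  "('a, 'e) chart set \<Rightarrow> ('b, 'f) chart set \<Rightarrow> ('a \<times> 'b, 'e \<times> 'f) chart set" where
  "product_atlas \<A> \<B> = {(U \<times> V, map_prod \<phi> \<psi>) | U \<phi> V \<psi>. (U, \<phi>) \<in> \<A> \<and> (V, \<psi>) \<in> \<B>}"

definition smooth_function ::
  "('a, 'e::real_normed_vector) chart set \<Rightarrow> ('a \<Rightarrow> real) \<Rightarrow> bool" where
  "smooth_function \<A> f \<longleftrightarrow> (\<forall>(U, \<phi>)\<in>\<A>. smooth_on (\<phi> ` U) (f \<circ> inv_into U \<phi>))"


section \<open>The causal variational principle\<close>

definition regular_borel_measure :: "'a::topological_space measure \<Rightarrow> bool" where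
  "regular_borel_measure \<rho> \<longleftrightarrow>
     sets \<rho> = sets borel \<and>
     (\<forall>B\<in>sets borel.
        emeasure \<rho> B = (SUP K\<in>{K. compact K \<and> K \<subseteq> B}. emeasure \<rho> K) \<and>
        emeasure \<rho> B = (INF U\<in>{U. open U \<and> B \<subseteq> U}. emeasure \<rho> U))"

definition normalized_measures :: "'a::topological_space measure set" where
  "normalized_measures = {\<rho>. regular_borel_measure \<rho> \<and> emeasure \<rho> UNIV = 1}"

definition supp :: "'a::topological_space measure \<Rightarrow> 'a set" where
  "supp \<rho> = {x. \<forall>U. open U \<and> x \<in> U \<longrightarrow> emeasure \<rho> U \<noteq> 0}"

definition Lagrangian :: "('a \<times> 'a \<Rightarrow> real) \<Rightarrow> 'a \<times> 'a \<Rightarrow> real" where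
  "Lagrangian D p = max 0 (D p)"

definition action :: "('a \<times> 'a \<Rightarrow> real) \<Rightarrow> 'a measure \<Rightarrow> real" where
  "action D \<rho> = (LINT p|(\<rho> \<Otimes>\<^sub>M \<rho>). Lagrangian D p)"

definition min_action :: "('a::topological_space \<times> 'a \<Rightarrow> real) \<Rightarrow> real" where
  "min_action D = (INF \<rho>\<in>normalized_measures. action D \<rho>)"

definition minimizer :: "('a::topological_space \<times> 'a \<Rightarrow> real) \<Rightarrow> 'a measure \<Rightarrow> bool" where
  "minimizer D \<rho> \<longleftrightarrow> \<rho> \<in> normalized_measures \<and> action D \<rho> = min_action D"

definition ell :: "('a \<times> 'a \<Rightarrow> real) \<Rightarrow> 'a measure \<Rightarrow> 'a \<Rightarrow> real" where
  "ell D \<rho> x = (LINT y|\<rho>. Lagrangian D (x, y))"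

end

theory Submission imports Defs begin

text \<open>
  Moving a fraction \<open>t\<close> of the mass of the minimizer \<open>\<rho>\<close> to a point \<open>x\<close> changes the action to
  \<open>(1 - t)\<^sup>2 S[\<rho>] + 2 t (1 - t) \<ell>(x) + t\<^sup>2 L(x,x)\<close>. Minimality and \<open>t \<rightarrow> 0\<close> give \<open>\<ell>(x) \<ge> S[\<rho>]\<close>. As the
  \<open>\<rho>\<close>-mean of \<open>\<ell>\<close> is \<open>S[\<rho>]\<close>, equality holds \<open>\<rho>\<close>-almost everywhere, hence by continuity of
  \<open>\<ell>\<close> on the whole support.
\<close>

text \<open>Continuity is local, and on a product chart \<open>D\<close> is its coordinate
  expression composed with the chart map. The coordinate expression is continuous by the case
  \<open>k = 0\<close> of \<open>Ck_on\<close>.\<close>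

lemma continuous_smooth_function:
  fixes \<A> :: "('a::{t2_space, second_countable_topology}, 'e::real_normed_vector) chart set"
  assumes A: "smooth_atlas \<A>" and D: "smooth_function (product_atlas \<A> \<A>) D"
  shows "continuous_on UNIV D"
proof -
  have "isCont D (x, y)" for x y
  proof -
    from A have "x \<in> (\<Union>c\<in>\<A>. fst c)" "y \<in> (\<Union>c\<in>\<A>. fst c)"
      by (auto simp: smooth_atlas_def)
    then obtain U \<phi> V \<psi> where U: "(U, \<phi>) \<in> \<A>" "x \<in> U" and V: "(V, \<psi>) \<in> \<A>" "y \<in> V"
      by auto
    have cU: "is_chart (U, \<phi>)" and cV: "is_chart (V, \<psi>)"
      using A U V by (auto simp: smooth_atlas_def)
    then have op: "open U" "open V"
      by (auto simp: is_chart_def)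
    have cont: "continuous_on U \<phi>" "continuous_on V \<psi>" and inj: "inj_on \<phi> U" "inj_on \<psi> V"
      using cU cV by (auto simp: is_chart_def homeomorphism_def intro: inj_on_inverseI)
    let ?f = "map_prod \<phi> \<psi>"
    have "(U \<times> V, ?f) \<in> product_atlas \<A> \<A>"
      using U V by (auto simp: product_atlas_def)
    then have "smooth_on (?f ` (U \<times> V)) (D \<circ> inv_into (U \<times> V) ?f)"
      using D by (auto simp: smooth_function_def)
    then have "Ck_on 0 (?f ` (U \<times> V)) (D \<circ> inv_into (U \<times> V) ?f)"
      by (auto simp only: smooth_on_def)
    then have *: "continuous_on (?f ` (U \<times> V)) (D \<circ> inv_into (U \<times> V) ?f)"
      by simp
    have "continuous_on (U \<times> V) ?f"
      unfolding map_prod_def split_def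
      by (intro continuous_on_Pair continuous_on_compose2[OF cont(1)] continuous_on_compose2[OF cont(2)]
          continuous_on_fst continuous_on_snd continuous_on_id) auto
    then have "continuous_on (U \<times> V) ((D \<circ> inv_into (U \<times> V) ?f) \<circ> ?f)"
      using * by (rule continuous_on_compose)
    \<comment> \<open>Injectivity lets \<open>inv_into\<close> cancel the chart map, so that the
      composite agrees with \<open>D\<close> on the chart domain.\<close>
    moreover have "inj_on ?f (U \<times> V)"
      using inj by (rule map_prod_inj_on)
    ultimately have "continuous_on (U \<times> V) D"
      by (subst continuous_on_cong[OF refl, of _ _ "(D \<circ> inv_into (U \<times> V) ?f) \<circ> ?f"]) auto
    then show ?thesis
      using op U(2) V(2) by (simp add: continuous_on_eq_continuous_at open_Times)
  qed
  then show ?thesis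
    by (simp add: continuous_on_eq_continuous_at split_paired_all)
qed

lemma normalized_measuresD:
  assumes "\<rho> \<in> normalized_measures"
  shows "sets \<rho> = sets borel" "space \<rho> = UNIV" "prob_space \<rho>"
proof -
  show s: "sets \<rho> = sets borel"
    using assms by (auto simp: normalized_measures_def regular_borel_measure_def)
  then show sp: "space \<rho> = UNIV"
    using sets_eq_imp_space_eq[of \<rho> borel] by simp
  show "prob_space \<rho>"
    using assms sp by (intro prob_spaceI) (auto simp: normalized_measures_def)
qed

text \<open>This is the convex combination of the Dirac measure at \<open>x\<close> (weight
  \<open>t\<close>) and \<open>\<rho>\<close> (weight \<open>1 - t\<close>). Writing it as a biased
  coin flip followed by a choice of measure reduces its measure and integral formulas to the rules
  for \<open>bind\<close>.\<close>

definition mix_point :: "real \<Rightarrow> 'a::topological_space \<Rightarrow> 'a measure \<Rightarrow> 'a measure" where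
  "mix_point t x \<rho> = measure_pmf (bernoulli_pmf t) \<bind> (\<lambda>b. if b then return borel x else \<rho>)"

context
  fixes \<rho> :: "'a::topological_space measure" and t :: real
  assumes prob: "prob_space \<rho>" and sets: "sets \<rho> = sets borel" and t: "0 \<le> t" "t \<le> 1"
begin

interpretation prob_space \<rho> by (fact prob)

lemma mix_point_kernel:
  "(\<lambda>b. if b then return borel x else \<rho>) \<in> measurable (measure_pmf (bernoulli_pmf t)) (subprob_algebra borel)"
  using sets prob_space_imp_subprob_space[OF prob]
    prob_space_imp_subprob_space[OF prob_space_return[of x borel]]
  by (auto simp: space_subprob_algebra)

lemma sets_mix_point: "sets (mix_point t x \<rho>) = sets borel"
  unfolding mix_point_def by (rule sets_bind[where N=borel]) (auto simp: sets)

lemma emeasure_mix_point: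
  assumes "B \<in> sets borel"
  shows "emeasure (mix_point t x \<rho>) B = indicator B x * ennreal t + emeasure \<rho> B * ennreal (1 - t)"
  using assms t by (simp add: mix_point_def emeasure_bind[OF _ mix_point_kernel])

text \<open>Boundedness of \<open>f\<close>, together with kernel masses at most 1, justifies
  integrating first over each branch and then over the coin, which leaves a two-term sum.\<close>

lemma integral_mix_point:
  fixes f :: "'a \<Rightarrow> real"
  assumes f: "f \<in> borel_measurable borel" and b: "\<And>y. \<bar>f y\<bar> \<le> M"
  shows "(LINT y|mix_point t x \<rho>. f y) = t * f x + (1 - t) * (LINT y|\<rho>. f y)"
proof -
  have "(LINT y|mix_point t x \<rho>. f y) =
      (LINT c|measure_pmf (bernoulli_pmf t). LINT y|(if c then return borel x else \<rho>). f y)"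
    unfolding mix_point_def
  proof (rule integral_bind[where B=M and B'=1 and K=borel])
    show "AE c in measure_pmf (bernoulli_pmf t). emeasure (if c then return borel x else \<rho>)
        (space (if c then return borel x else \<rho>)) \<le> ennreal 1"
      by (intro AE_I2) (auto simp: emeasure_space_1)
  qed (use b f mix_point_kernel measure_pmf.finite_measure_axioms in auto)
  then show ?thesis
    using t f by (simp add: integral_return mult.commute)
qed

end

text \<open>The point to check is regularity. Approximating sets for \<open>\<rho>\<close> are
  corrected at the single point \<open>x\<close> so that the Dirac part is matched exactly; only the
  \<open>\<rho>\<close> part then contributes an error.\<close>

lemma mix_point_normalized:
  fixes x :: "'a::t2_space"
  assumes \<rho>: "\<rho> \<in> normalized_measures" and t: "0 \<le> t" "t \<le> 1"
  shows "mix_point t x \<rho> \<in> normalized_measures"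
proof -
  note [simp] = normalized_measuresD(1)[OF \<rho>]
  interpret prob_space \<rho> using normalized_measuresD[OF \<rho>] by simp
  note em = emeasure_mix_point[OF prob_space_axioms normalized_measuresD(1)[OF \<rho>] t]
  note st = sets_mix_point[OF prob_space_axioms normalized_measuresD(1)[OF \<rho>] t]
  have mono: "emeasure (mix_point t x \<rho>) A \<le> emeasure (mix_point t x \<rho>) B"
    if "A \<subseteq> B" "B \<in> sets borel" for A B
    using that by (intro emeasure_mono) (auto simp: st)
  \<comment> \<open>Used to bound the scaled error \<open>e * (1 - t)\<close> by
    \<open>e\<close>.\<close>
  have shrink: "u * ennreal (1 - t) \<le> u" for u
    using t mult_left_mono[of "ennreal (1 - t)" 1 u] by (simp add: ennreal_le_1)
  have reg: "emeasure \<rho> B = (SUP K\<in>{K. compact K \<and> K \<subseteq> B}. emeasure \<rho> K)"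
       "emeasure \<rho> B = (INF U\<in>{U. open U \<and> B \<subseteq> U}. emeasure \<rho> U)" if "B \<in> sets borel" for B
    using \<rho> that unfolding normalized_measures_def regular_borel_measure_def by blast+
  have "emeasure (mix_point t x \<rho>) B = (SUP K\<in>{K. compact K \<and> K \<subseteq> B}. emeasure (mix_point t x \<rho>) K)"
    if B: "B \<in> sets borel" for B
  proof (rule ennreal_approx_SUP)
    fix e :: real assume "e > 0"
    have "{K. compact K \<and> K \<subseteq> B} \<noteq> {}"
      using compact_empty by blast
    then obtain K where K: "compact K" "K \<subseteq> B" and le: "emeasure \<rho> B < emeasure \<rho> K + e"
      using SUP_approx_ennreal[OF \<open>e > 0\<close> _ reg(1)[OF B]] by auto
    \<comment> \<open>Adds \<open>x\<close> exactly when it lies in \<open>B\<close>; the set stays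
      compact and inside \<open>B\<close>.\<close>
    let ?K = "K \<union> (B \<inter> {x})"
    have cK: "compact ?K" using K by (cases "x \<in> B") (auto simp: compact_Un)
    have "emeasure (mix_point t x \<rho>) B \<le> indicator B x * ennreal t + (emeasure \<rho> K + e) * ennreal (1 - t)"
      unfolding em[OF B] using le by (intro add_mono mult_right_mono) auto
    also have "\<dots> \<le> indicator B x * ennreal t + (emeasure \<rho> ?K * ennreal (1 - t) + e)"
      unfolding distrib_right using cK
      by (intro add_mono mult_right_mono emeasure_mono shrink order_refl) (auto simp: compact_imp_closed)
    also have "\<dots> = emeasure (mix_point t x \<rho>) ?K + e"
      using cK K by (subst em) (auto simp: compact_imp_closed add.assoc indicator_def)
    finally show "\<exists>K\<in>{K. compact K \<and> K \<subseteq> B}. emeasure (mix_point t x \<rho>) B \<le> emeasure (mix_point t x \<rho>) K + e"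
      using cK K by (intro bexI[of _ ?K]) auto
  qed (use B in \<open>auto intro: mono\<close>)
  moreover
  have "emeasure (mix_point t x \<rho>) B = (INF U\<in>{U. open U \<and> B \<subseteq> U}. emeasure (mix_point t x \<rho>) U)"
    if B: "B \<in> sets borel" for B
  proof (rule ennreal_approx_INF)
    fix e :: real assume "e > 0"
    then obtain U where U: "open U" "B \<subseteq> U" and le: "emeasure \<rho> U < emeasure \<rho> B + e"
      using INF_approx_ennreal[OF _ reg(2)[OF B]] by auto
    \<comment> \<open>Dually, removes \<open>x\<close> exactly when it lies outside
      \<open>B\<close>. What is removed is empty or a singleton, hence closed.\<close>
    let ?U = "U - ({x} - B)"
    have "closed ({x} - B)"
      by (cases "x \<in> B") (auto simp: insert_Diff_if)
    with U have oU: "open ?U" by (intro open_Diff)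
    have "emeasure (mix_point t x \<rho>) ?U = indicator B x * ennreal t + emeasure \<rho> ?U * ennreal (1 - t)"
      using oU U by (subst em) (auto simp: indicator_def)
    also have "\<dots> \<le> indicator B x * ennreal t + (emeasure \<rho> B + e) * ennreal (1 - t)"
      using le oU U emeasure_mono[of ?U U \<rho>] by (intro add_mono mult_right_mono) auto
    also have "\<dots> \<le> indicator B x * ennreal t + (emeasure \<rho> B * ennreal (1 - t) + e)"
      unfolding distrib_right by (intro add_mono shrink order_refl)
    also have "\<dots> = emeasure (mix_point t x \<rho>) B + e"
      using B by (subst em) (auto simp: add.assoc)
    finally show "\<exists>U\<in>{U. open U \<and> B \<subseteq> U}. emeasure (mix_point t x \<rho>) U \<le> emeasure (mix_point t x \<rho>) B + e"
      using oU U by (intro bexI[of _ ?U]) auto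
  qed (auto intro: mono)
  moreover have "emeasure (mix_point t x \<rho>) UNIV = 1"
    using t emeasure_space_1
    by (simp add: em normalized_measuresD(2)[OF \<rho>] flip: ennreal_plus)
  ultimately show ?thesis
    unfolding normalized_measures_def regular_borel_measure_def
    by (intro CollectI conjI ballI st)
qed

text \<open>Subtracting \<open>S\<close> from both sides and dividing by \<open>2 * t\<close> leaves
  \<open>S \<le> l + t * (S / 2 - l + m / 2)\<close>; now let \<open>t\<close> tend to 0 from the
  right.\<close>

lemma le_linear_coeff_of_quadratic_min:
  fixes S l m :: real
  assumes "\<And>t. 0 < t \<Longrightarrow> t \<le> 1 \<Longrightarrow> S \<le> (1 - t)\<^sup>2 * S + 2 * t * (1 - t) * l + t\<^sup>2 * m"
  shows "S \<le> l"
proof (rule tendsto_lowerbound)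
  show "((\<lambda>t. l + t * (S / 2 - l + m / 2)) \<longlongrightarrow> l) (at_right 0)"
    by (auto intro!: tendsto_eq_intros)
  have "\<forall>\<^sub>F t in at_right (0::real). t \<in> {0<..<1}"
    by (rule eventually_at_right_real) simp
  then show "\<forall>\<^sub>F t in at_right (0::real). S \<le> l + t * (S / 2 - l + m / 2)"
  proof eventually_elim
    case (elim t)
    then have "0 \<le> 2 * t * (l + t * (S / 2 - l + m / 2) - S)"
      using assms[of t] by (simp add: power2_eq_square algebra_simps)
    with elim show ?case by (simp add: zero_le_mult_iff)
  qed
qed simp

theorem lemma3p4:
  fixes \<A> :: "('a::{t2_space, second_countable_topology}, 'e::real_normed_vector) chart set"
    and D :: "'a \<times> 'a \<Rightarrow> real"
    and \<rho> :: "'a measure"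
  assumes "compact_smooth_manifold \<A>"
    and "smooth_function (product_atlas \<A> \<A>) D"
    and "\<And>x y. D (x, y) = D (y, x)"
    and "\<And>x. D (x, x) > 0"
    and "minimizer D \<rho>"
  shows "ell D \<rho> constant_on supp \<rho> \<and>
         (\<forall>x\<in>supp \<rho>. ell D \<rho> x = (INF z. ell D \<rho> z)) \<and>
         (INF z. ell D \<rho> z) = min_action D"
proof -
  have "continuous_on UNIV D"
    using assms continuous_smooth_function by (auto simp: compact_smooth_manifold_def)
  then have cont: "continuous_on UNIV (Lagrangian D)"
    unfolding Lagrangian_def by (intro continuous_intros)
  moreover have "compact (UNIV :: ('a \<times> 'a) set)"
    using assms(1) compact_Times[of "UNIV :: 'a set" "UNIV :: 'a set"]
    by (simp add: compact_smooth_manifold_def)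
  ultimately have "bounded (range (Lagrangian D))"
    by (intro compact_imp_bounded compact_continuous_image)
  then obtain M where M: "\<And>p. \<bar>Lagrangian D p\<bar> \<le> M"
    by (auto simp: bounded_iff)
  \<comment> \<open>Second countability identifies the product of the Borel algebras with the Borel
    algebra of the product.\<close>
  have meas: "Lagrangian D \<in> borel_measurable (borel \<Otimes>\<^sub>M borel)"
    using cont by (simp add: borel_prod borel_measurable_continuous_onI)
  have sym: "Lagrangian D (x, y) = Lagrangian D (y, x)" for x y
    using assms(3)[of x y] by (simp add: Lagrangian_def)

  \<comment> \<open>Dominated convergence along sequences, with the constant \<open>M\<close> as
    majorant. A general \<open>\<mu>\<close> is treated because these facts are also applied to the
    mixtures below.\<close>
  have ell_cont: "isCont (ell D \<mu>) x" if \<mu>: "\<mu> \<in> normalized_measures" for \<mu> x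
  proof (rule continuous_at_sequentiallyI)
    fix u assume u: "u \<longlonglongrightarrow> x"
    interpret prob_space \<mu> using normalized_measuresD[OF \<mu>] by simp
    note [measurable_cong] = normalized_measuresD(1)[OF \<mu>]
    note [measurable] = meas
    show "(\<lambda>n. ell D \<mu> (u n)) \<longlonglongrightarrow> ell D \<mu> x"
      unfolding ell_def
    proof (rule integral_dominated_convergence[where w="\<lambda>_. M"])
      show "AE y in \<mu>. (\<lambda>n. Lagrangian D (u n, y)) \<longlonglongrightarrow> Lagrangian D (x, y)"
        using u by (intro AE_I2 continuous_on_tendsto_compose[OF cont] tendsto_intros) auto
    qed (use M in auto)
  qed
  have ell_meas: "ell D \<mu> \<in> borel_measurable borel" if "\<mu> \<in> normalized_measures" for \<mu>
    using ell_cont[OF that] by (intro borel_measurable_continuous_onI) (simp add: continuous_at_imp_continuous_on)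
  have L_int: "integrable \<mu> (\<lambda>y. Lagrangian D (x, y))" if \<mu>: "\<mu> \<in> normalized_measures" for \<mu> x
  proof -
    interpret prob_space \<mu> using normalized_measuresD[OF \<mu>] by simp
    note [measurable_cong] = normalized_measuresD(1)[OF \<mu>]
    note [measurable] = meas
    show ?thesis
      by (rule integrable_const_bound[where B=M]) (use M in auto)
  qed
  have ell_bd: "\<bar>ell D \<mu> x\<bar> \<le> M" if \<mu>: "\<mu> \<in> normalized_measures" for \<mu> x
  proof -
    interpret prob_space \<mu> using normalized_measuresD[OF \<mu>] by simp
    have "norm (ell D \<mu> x) \<le> (LINT y|\<mu>. norm (Lagrangian D (x, y)))"
      unfolding ell_def by (rule integral_norm_bound)
    also have "\<dots> \<le> M"
      using M L_int[OF \<mu>] by (intro integral_le_const AE_I2) auto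
    finally show ?thesis by simp
  qed
  \<comment> \<open>Fubini; the bounded kernel is integrable over a product of probability
    measures.\<close>
  have action_eq: "action D \<mu> = (LINT x|\<mu>. ell D \<mu> x)" if \<mu>: "\<mu> \<in> normalized_measures" for \<mu>
  proof -
    interpret prob_space \<mu> using normalized_measuresD[OF \<mu>] by simp
    interpret P: pair_prob_space \<mu> \<mu> ..
    note [measurable_cong] = normalized_measuresD(1)[OF \<mu>]
    note [measurable] = meas
    have "integrable (\<mu> \<Otimes>\<^sub>M \<mu>) (Lagrangian D)"
      by (rule P.integrable_const_bound[where B=M]) (use M in auto)
    from P.integral_fst'[OF this] show ?thesis
      by (simp add: action_def ell_def)
  qed

  have \<rho>: "\<rho> \<in> normalized_measures" and min: "action D \<rho> = min_action D"
    using assms(5) by (auto simp: minimizer_def)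
  note \<rho>D = normalized_measuresD[OF \<rho>]
  interpret prob_space \<rho> by (fact \<rho>D(3))
  have int: "integrable \<rho> (ell D \<rho>)"
    using ell_meas[OF \<rho>] ell_bd[OF \<rho>] measurable_cong_sets[OF \<rho>D(1) refl]
    by (intro integrable_const_bound[where B=M]) auto
  define S where "S = min_action D"
  have S: "S = (LINT x|\<rho>. ell D \<rho> x)"
    using min action_eq[OF \<rho>] by (simp add: S_def)
  have S_le: "S \<le> action D \<mu>" if "\<mu> \<in> normalized_measures" for \<mu>
    unfolding S_def min_action_def
  proof (rule cINF_lower[OF _ that])
    \<comment> \<open>Nonnegativity of the Lagrangian makes the real infimum a genuine lower
      bound.\<close>
    show "bdd_below (action D ` normalized_measures)"
      by (rule bdd_belowI2[where m=0]) (auto simp: action_def Lagrangian_def)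
  qed

  have ge: "S \<le> ell D \<rho> x" for x
  proof (rule le_linear_coeff_of_quadratic_min)
    fix t :: real assume t: "0 < t" "t \<le> 1"
    let ?\<mu> = "mix_point t x \<rho>"
    have \<mu>: "?\<mu> \<in> normalized_measures"
      using \<rho> t by (intro mix_point_normalized) auto
    have mix: "(LINT y|?\<mu>. f y) = t * f x + (1 - t) * (LINT y|\<rho>. f y)"
      if "f \<in> borel_measurable borel" "\<And>y. \<bar>f y\<bar> \<le> M" for f :: "'a \<Rightarrow> real"
      using integral_mix_point[OF \<rho>D(3,1) _ t(2) that] t by simp
    \<comment> \<open>The mixture formula is used twice: here in the inner variable, and below in
      the outer one.\<close>
    have ell_mix: "ell D ?\<mu> y = t * Lagrangian D (y, x) + (1 - t) * ell D \<rho> y" for y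
      unfolding ell_def using M measurable_compose[OF measurable_Pair1' meas] by (intro mix) auto
    have "integrable \<rho> (\<lambda>y. Lagrangian D (y, x))"
      using L_int[OF \<rho>, of x] by (simp add: sym[of x])
    then have "(LINT y|\<rho>. ell D ?\<mu> y) = t * (LINT y|\<rho>. Lagrangian D (y, x)) + (1 - t) * S"
      unfolding ell_mix S using int by simp
    \<comment> \<open>Symmetry makes the two cross terms equal, whence the factor 2 in the
      quadratic.\<close>
    also have "(LINT y|\<rho>. Lagrangian D (y, x)) = ell D \<rho> x"
      unfolding ell_def by (simp add: sym[of _ x])
    finally have "action D ?\<mu> = t * (t * Lagrangian D (x, x) + (1 - t) * ell D \<rho> x)
        + (1 - t) * (t * ell D \<rho> x + (1 - t) * S)"
      by (simp only: action_eq[OF \<mu>] mix[OF ell_meas[OF \<mu>] ell_bd[OF \<mu>]] ell_mix[of x])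
    with S_le[OF \<mu>] show "S \<le> (1 - t)\<^sup>2 * S + 2 * t * (1 - t) * ell D \<rho> x + t\<^sup>2 * Lagrangian D (x, x)"
      by (simp add: power2_eq_square algebra_simps)
  qed

  \<comment> \<open>By \<open>ge\<close> the integrand is nonnegative, so a zero integral forces it
    to vanish almost everywhere.\<close>
  have "(LINT x|\<rho>. ell D \<rho> x - S) = 0"
    using int S by (simp add: prob_space)
  then have "AE x in \<rho>. ell D \<rho> x - S = 0"
    using int ge by (subst (asm) integral_nonneg_eq_0_iff_AE) auto
  then have ae: "AE x in \<rho>. ell D \<rho> x = S"
    by simp
  have on_supp: "ell D \<rho> x = S" if x: "x \<in> supp \<rho>" for x
  proof (rule ccontr)
    assume "ell D \<rho> x \<noteq> S"
    \<comment> \<open>By continuity of \<open>ell D \<rho>\<close> this is an open neighborhood of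
      \<open>x\<close>, yet it is a null set, contradicting
      \<open>x \<in> supp \<rho>\<close>.\<close>
    define U where "U = {y. ell D \<rho> y \<noteq> S}"
    have "open U"
      unfolding U_def using ell_cont[OF \<rho>]
      by (intro open_Collect_neq) (auto simp: continuous_at_imp_continuous_on)
    moreover have "emeasure \<rho> U = 0"
      using emeasure_eq_0_AE[of "\<lambda>y. ell D \<rho> y \<noteq> S" \<rho>] ae unfolding U_def \<rho>D(2) by simp
    ultimately show False
      using x \<open>ell D \<rho> x \<noteq> S\<close> by (auto simp: supp_def U_def)
  qed
  \<comment> \<open>An almost sure property of a probability measure holds at some point; hence the
    lower bound \<open>S\<close> is attained and is the infimum.\<close>
  have "\<exists>z. ell D \<rho> z = S"
  proof (rule ccontr)
    assume "\<nexists>z. ell D \<rho> z = S"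
    with ae have "AE x in \<rho>. False" by simp
    then show False by simp
  qed
  then obtain z where z: "ell D \<rho> z = S" ..
  have "(INF z. ell D \<rho> z) = S"
    by (rule cInf_eq_minimum) (use ge z in auto)
  then show ?thesis
    using on_supp by (auto simp: constant_on_def S_def)
qed

end
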